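(* Let $\varepsilon>0$ and let $\rho_\varepsilon:\mathbb{R}^d\to[0,\infty]$ be a measurable kernel whose essential support is $\overline{B_\varepsilon(0)}$. Let $E\subset\mathbb{R}^d$ be a measurable set with $\mathbb{P}_\varepsilon(E)<\infty$. Then $E$ is $\varepsilon$-decomposable if and only if there exists a partition $\{E_1,E_2\}$ of $E$ into measurable sets such that $|E_1|,|E_2|>0$ and $$\operatorname{dist}^e(E_1,E_2):=\inf_{\substack{x\in\operatorname{supp}(\mathcal{L}^d\llcorner E_1)\\ y\in\operatorname{supp}(\mathcal{L}^d\llcorner E_2)}}|x-y|\ \geq\ \varepsilon .$$
   Context: For measurable $E\subset\mathbb{R}^d$ the Gagliardo $\mathbb{P}_\varepsilon$-perimeter is $$\mathbb{P}_\varepsilon(E):=\int_{\mathbb{R}^d}\int_{\mathbb{R}^d}\frac{|\mathbf{1}_E(x)-\mathbf{1}_E(y)|}{|x-y|}\rho_\varepsilon(x-y)\,dx\,dy .$$ A set $E$ with $\mathbb{P}_\varepsilon(E)<\infty$ is called $\varepsilon$-decomposable if there is a partition $\{E_1,E_2\}$ of $E$ into sets of finite $\mathbb{P}_\varepsilon$-perimeter with $|E_1|,|E_2|>0$ and $\mathbb{P}_\varepsilon(E)=\mathbb{P}_\varepsilon(E_1)+\mathbb{P}_\varepsilon(E_2)$. $\mathcal{L}^d$ is Lebesgue measure, also written $|\cdot|$; $\mathcal{L}^d\llcorner F$ is its restriction to $F$; the support of a nonnegative measure $\mu$ is the smallest closed set $F$ with $\mu(\mathbb{R}^d\setminus F)=0$.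 The essential support of $\rho_\varepsilon$ is the smallest closed set outside of which $\rho_\varepsilon=0$ a.e. *)

theory Defs
  imports "HOL-Analysis.Analysis"
begin

text \<open>
  The perimeter depends on \<open>\<epsilon>\<close> only through the kernel \<open>\<rho>\<close>, so the kernel is the parameter.
  The kernel takes values in \<open>[0, \<infinity>]\<close>; on the diagonal the first factor is \<open>0 / 0 = 0\<close> and
  \<open>0 * \<infinity> = 0\<close>, so the integrand vanishes there.
\<close>

definition gagliardo_perimeter :: "('a::euclidean_space \<Rightarrow> ennreal) \<Rightarrow> 'a set \<Rightarrow> ennreal" where
  "gagliardo_perimeter \<rho> E =
     (\<integral>\<^sup>+ y. (\<integral>\<^sup>+ x. ennreal (\<bar>indicat_real E x - indicat_real E y\<bar> / norm (x - y)) * \<rho> (x - y)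
        \<partial>lebesgue) \<partial>lebesgue)"

definition decomposable :: "('a::euclidean_space \<Rightarrow> ennreal) \<Rightarrow> 'a set \<Rightarrow> bool" where
  "decomposable \<rho> E \<longleftrightarrow>
     E \<in> sets lebesgue \<and> gagliardo_perimeter \<rho> E < \<infinity> \<and>
     (\<exists>E1 E2. E1 \<in> sets lebesgue \<and> E2 \<in> sets lebesgue \<and>
        E1 \<union> E2 = E \<and> E1 \<inter> E2 = {} \<and>
        gagliardo_perimeter \<rho> E1 < \<infinity> \<and> gagliardo_perimeter \<rho> E2 < \<infinity> \<and>
        emeasure lebesgue E1 > 0 \<and> emeasure lebesgue E2 > 0 \<and>
        gagliardo_perimeter \<rho> E = gagliardo_perimeter \<rho> E1 + gagliardo_perimeter \<rho> E2)"

text \<open>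
  The least elements below are taken with respect to inclusion; they exist by the Lindeloef
  property, see \<open>measure_support_smallest\<close> and \<open>ess_support_smallest\<close>. The definition of
  \<open>measure_support\<close> is meant for measures whose \<open>\<sigma>\<close>-algebra contains the Borel sets, because
  \<^const>\<open>emeasure\<close> is \<open>0\<close> on non-measurable sets.
\<close>

definition measure_support :: "'a::topological_space measure \<Rightarrow> 'a set" where
  "measure_support M = (LEAST F. closed F \<and> emeasure M (UNIV - F) = 0)"

definition ess_support :: "('a::euclidean_space \<Rightarrow> ennreal) \<Rightarrow> 'a set" where
  "ess_support f = (LEAST F. closed F \<and> (AE x in lebesgue. x \<notin> F \<longrightarrow> f x = 0))"

text \<open>
  The restriction is a measure on the whole space, hence a density; \<^const>\<open>restrict_space\<close> would
  change the underlying space to \<open>E\<close>.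
\<close>

definition lebesgue_restriction :: "'a::euclidean_space set \<Rightarrow> 'a measure" where
  "lebesgue_restriction E = density lebesgue (indicator E)"

definition ess_dist :: "'a::euclidean_space set \<Rightarrow> 'a set \<Rightarrow> ereal" where
  "ess_dist E1 E2 =
     (INF (x, y) \<in> measure_support (lebesgue_restriction E1)
                  \<times> measure_support (lebesgue_restriction E2). ereal (norm (x - y)))"

lemma Least_closed:
  fixes P :: "'a::second_countable_topology set \<Rightarrow> bool"
  assumes "\<And>\<F>. countable \<F> \<Longrightarrow> (\<And>F. F \<in> \<F> \<Longrightarrow> closed F \<and> P F) \<Longrightarrow> P (\<Inter>\<F>)"
  shows "closed (LEAST F. closed F \<and> P F) \<and> P (LEAST F. closed F \<and> P F)"
    and "closed G \<Longrightarrow> P G \<Longrightarrow> (LEAST F. closed F \<and> P F) \<subseteq> G"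
proof -
  let ?\<C> = "{F. closed F \<and> P F}"
  have "open S" if "S \<in> uminus ` ?\<C>" for S
    using that by auto
  then obtain \<O> where \<O>: "\<O> \<subseteq> uminus ` ?\<C>" "countable \<O>" "\<Union>\<O> = \<Union>(uminus ` ?\<C>)"
    using Lindelof[of "uminus ` ?\<C>"] by metis
  have mem: "F \<in> uminus ` \<O> \<Longrightarrow> closed F \<and> P F" for F
    using \<O>(1) by auto
  have "\<Inter>(uminus ` \<O>) = - \<Union>\<O>"
    by auto
  also have "\<dots> = \<Inter>?\<C>"
    unfolding \<O>(3) by auto
  finally have "P (\<Inter>?\<C>)"
    using assms[of "uminus ` \<O>"] mem \<O>(2) by (metis countable_image)
  moreover have "closed (\<Inter>?\<C>)"
    by auto
  moreover from calculation have "(LEAST F. closed F \<and> P F) = \<Inter>?\<C>"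
    by (intro Least_equality) auto
  ultimately show "closed (LEAST F. closed F \<and> P F) \<and> P (LEAST F. closed F \<and> P F)"
    and "closed G \<Longrightarrow> P G \<Longrightarrow> (LEAST F. closed F \<and> P F) \<subseteq> G"
    by auto
qed

lemma measure_support_smallest:
  fixes M :: "'a::second_countable_topology measure"
  assumes "sets borel \<subseteq> sets M"
  shows "closed (measure_support M) \<and> emeasure M (UNIV - measure_support M) = 0"
    and "closed G \<Longrightarrow> emeasure M (UNIV - G) = 0 \<Longrightarrow> measure_support M \<subseteq> G"
proof -
  have "emeasure M (UNIV - \<Inter>\<F>) = 0"
    if \<F>: "countable \<F>" "\<And>F. F \<in> \<F> \<Longrightarrow> closed F \<and> emeasure M (UNIV - F) = 0" for \<F>
  proof -
    have "UNIV - F \<in> null_sets M" if "F \<in> \<F>" for F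
    proof -
      have "UNIV - F \<in> sets borel" "emeasure M (UNIV - F) = 0"
        using \<F>(2)[OF that] by auto
      with assms show ?thesis
        by auto
    qed
    with \<F>(1) have "(\<Union>F\<in>\<F>. UNIV - F) \<in> null_sets M"
      by (intro null_sets_UN') auto
    moreover have "(\<Union>F\<in>\<F>. UNIV - F) = UNIV - \<Inter>\<F>"
      by auto
    ultimately show ?thesis
      by auto
  qed
  note * = Least_closed[of "\<lambda>F. emeasure M (UNIV - F) = 0", OF this]
  show "closed (measure_support M) \<and> emeasure M (UNIV - measure_support M) = 0"
    and "closed G \<Longrightarrow> emeasure M (UNIV - G) = 0 \<Longrightarrow> measure_support M \<subseteq> G"
    unfolding measure_support_def using * by blast+
qed

lemma ess_support_smallest:
  shows "closed (ess_support f) \<and> (AE x in lebesgue. x \<notin> ess_support f \<longrightarrow> f x = 0)"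
    and "closed G \<Longrightarrow> (AE x in lebesgue. x \<notin> G \<longrightarrow> f x = 0) \<Longrightarrow> ess_support f \<subseteq> G"
proof -
  have "AE x in lebesgue. x \<notin> \<Inter>\<F> \<longrightarrow> f x = 0"
    if \<F>: "countable \<F>" "\<And>F. F \<in> \<F> \<Longrightarrow> closed F \<and> (AE x in lebesgue. x \<notin> F \<longrightarrow> f x = 0)" for \<F>
  proof -
    have "AE x in lebesgue. \<forall>F\<in>\<F>. x \<notin> F \<longrightarrow> f x = 0"
      using \<F> by (intro AE_ball_countable[THEN iffD2]) blast+
    then show ?thesis
      by eventually_elim auto
  qed
  note * = Least_closed[of "\<lambda>F. AE x in lebesgue. x \<notin> F \<longrightarrow> f x = 0", OF this]
  show "closed (ess_support f) \<and> (AE x in lebesgue. x \<notin> ess_support f \<longrightarrow> f x = 0)"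
    and "closed G \<Longrightarrow> (AE x in lebesgue. x \<notin> G \<longrightarrow> f x = 0) \<Longrightarrow> ess_support f \<subseteq> G"
    unfolding ess_support_def using * by blast+
qed

end

theory Submission
  imports Defs
begin

text \<open>
  Write \<open>K z = \<rho> z / |z|\<close>, let \<open>J(A, B)\<close> be the integral of \<open>K (x - y)\<close> over \<open>x \<in> A\<close>, \<open>y \<in> B\<close>
  (\<open>interaction\<close>), and let \<open>C\<close> be the complement of \<open>E\<close>. The perimeter is \<open>J(C, E) + J(E, C)\<close>, so by
  additivity of \<open>J\<close> in both arguments a partition of \<open>E\<close> satisfies
  \<open>P(E1) + P(E2) = P(E) + 2 (J(E1, E2) + J(E2, E1))\<close> (\<open>gagliardo_perimeter_partition\<close>).
  As \<open>P(E)\<close> is finite, the partition decomposes \<open>E\<close> iff its two parts do not interact at all, and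
  it remains to see that this means that they have essential distance at least \<open>\<epsilon>\<close>.

  Both conditions are compared with a third one about the overlap function
  \<open>z \<mapsto> |{y \<in> B. y + z \<in> A}|\<close>, namely that it vanishes for all \<open>|z| < \<epsilon>\<close>.

  \<^item> Fubini turns \<open>J(A, B)\<close> into the integral of \<open>K\<close> times the overlap function
    (\<open>interaction_eq_overlap\<close>), so \<open>J(A, B) = 0\<close> means that \<open>K\<close> vanishes almost everywhere where the
    overlap is positive. The kernel may vanish on a set of positive measure inside the ball, hence
    this alone does not determine the overlap there. But the set where the overlap is positive is
    open (\<open>open_overlap_pos\<close>, by an argument of Steinhaus), and no nonempty open subset of the ball
    can be a null set for \<open>\<rho>\<close>, because the ball lies in the essential support.

  \<^item> With the constant kernel \<open>1\<close> the same Fubini identity says that the overlap function has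
    integral \<open>|A| |B|\<close>. Applied to the parts of \<open>A\<close> and \<open>B\<close> in small balls around two support points
    at distance less than \<open>\<epsilon>\<close>, it yields a \<open>z\<close> in the \<open>\<epsilon>\<close>-ball with positive overlap
    (\<open>ess_dist_ge_iff_overlap\<close>).
\<close>

section \<open>Translations and Borel representatives\<close>

lemma AE_lebesgue_translation:
  fixes a :: "'a::euclidean_space"
  assumes "AE x in lebesgue. P x"
  shows "AE x in lebesgue. P (x + a)"
proof -
  obtain N where N: "N \<in> null_sets lborel" "{x. \<not> P x} \<subseteq> N"
    using assms unfolding AE_completion_iff by (auto elim!: AE_E simp: null_sets_def)
  then have "{x. x - - a \<in> N} \<in> null_sets lborel"
    by (intro null_sets_translation)
  then have "AE x in lborel. x - - a \<notin> N"
    using AE_not_in by fastforce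
  then have "AE x in lborel. P (x + a)"
    by eventually_elim (use N(2) in auto)
  then show ?thesis
    by (rule AE_completion)
qed

lemma nn_integral_lborel_translation:
  fixes a :: "'a::euclidean_space"
  assumes "f \<in> borel_measurable borel"
  shows "(\<integral>\<^sup>+ x. f x \<partial>lborel) = (\<integral>\<^sup>+ x. f (x + a) \<partial>lborel)"
proof -
  have "(\<integral>\<^sup>+ x. f x \<partial>lborel) = (\<integral>\<^sup>+ x. f x \<partial>distr lborel borel ((+) a))"
    by (simp add: lborel_distr_plus)
  also have "\<dots> = (\<integral>\<^sup>+ x. f (a + x) \<partial>lborel)"
    using assms by (subst nn_integral_distr) auto
  finally show ?thesis
    by (simp add: add.commute)
qed

lemma emeasure_lebesgue_translation:
  fixes a :: "'a::euclidean_space"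
  shows "emeasure lebesgue ((+) a ` S) = emeasure lebesgue S"
  using emeasure_lebesgue_affine[of 1 a S] by (simp add: add.commute[of _ a])

text \<open>
  Fubini needs joint measurability on the Borel product, which \<open>(x, y) \<mapsto> K (x - y)\<close> has for Borel \<open>K\<close>;
  Lebesgue measurable sets and kernels are therefore exchanged for Borel ones.
\<close>

lemma lebesgue_set_AE_borel:
  assumes "S \<in> sets lebesgue"
  obtains S' where "S' \<in> sets borel" "AE x in lebesgue. x \<in> S \<longleftrightarrow> x \<in> S'"
proof -
  obtain B N where BN: "B \<in> sets borel" "negligible N" "B \<union> N = S"
    using sets_lebesgue_almost_borel[OF assms] by metis
  have "AE x in lebesgue. x \<notin> N"
    using BN(2) by (simp add: negligible_iff_null_sets AE_not_in)
  then have "AE x in lebesgue. x \<in> S \<longleftrightarrow> x \<in> B"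
    by eventually_elim (use BN(3) in auto)
  with BN(1) show thesis
    by (rule that)
qed

lemma lebesgue_measurable_cong_AE:
  fixes f g :: "'a::euclidean_space \<Rightarrow> 'b::topological_space"
  assumes g: "g \<in> borel_measurable lebesgue" and eq: "AE x in lebesgue. g x = f x"
  shows "f \<in> borel_measurable lebesgue"
proof (rule measurableI)
  fix X :: "'b set"
  assume X: "X \<in> sets borel"
  show "f -` X \<inter> space lebesgue \<in> sets lebesgue"
  proof (rule completion.in_sets_AE)
    show "AE x in lebesgue. x \<in> g -` X \<inter> space lebesgue \<longleftrightarrow> x \<in> f -` X \<inter> space lebesgue"
      using eq by eventually_elim auto
    show "g -` X \<inter> space lebesgue \<in> sets lebesgue"
      using g X by (rule measurable_sets)
  qed auto
qed simp

section \<open>Overlap of a set with the translates of another\<close>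

definition overlap :: "'a::euclidean_space set \<Rightarrow> 'a set \<Rightarrow> 'a \<Rightarrow> ennreal" where
  "overlap A B z = emeasure lebesgue {y \<in> B. y + z \<in> A}"

lemma overlap_set_measurable:
  assumes "A \<in> sets lebesgue" "B \<in> sets lebesgue"
  shows "{y \<in> B. y + z \<in> A} \<in> sets lebesgue"
proof -
  have "{y \<in> B. y + z \<in> A} = B \<inter> (+) (- z) ` A"
    by (auto simp: image_iff algebra_simps intro: bexI[of _ "_ + z"])
  then show ?thesis
    using assms lebesgue_sets_translation[of A "- z"] by auto
qed

lemma overlap_commute: "overlap B A (- z) = overlap A B z"
proof -
  have "{y \<in> A. y + - z \<in> B} = (+) z ` {y \<in> B. y + z \<in> A}"
    by (force simp: image_iff algebra_simps intro: exI[of _ "_ - z"])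
  then show ?thesis
    by (simp only: overlap_def emeasure_lebesgue_translation)
qed

text \<open>
  The equality holds at every \<open>z\<close>, not just almost everywhere; this is what allows pointwise
  statements about the overlap of Lebesgue sets to pass through Borel representatives.
\<close>

lemma overlap_cong_AE:
  assumes "AE x in lebesgue. x \<in> A \<longleftrightarrow> x \<in> A'" "AE x in lebesgue. x \<in> B \<longleftrightarrow> x \<in> B'"
    and "A \<in> sets lebesgue" "B \<in> sets lebesgue" "A' \<in> sets lebesgue" "B' \<in> sets lebesgue"
  shows "overlap A B z = overlap A' B' z"
  unfolding overlap_def
proof (rule emeasure_eq_AE)
  show "AE y in lebesgue. y \<in> {y \<in> B. y + z \<in> A} \<longleftrightarrow> y \<in> {y \<in> B'. y + z \<in> A'}"
    using assms(2) AE_lebesgue_translation[OF assms(1), of z] by eventually_elim auto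
qed (use assms overlap_set_measurable in blast)+

lemma overlap_Un_left:
  assumes "A \<inter> A' = {}" "A \<in> sets lebesgue" "A' \<in> sets lebesgue" "B \<in> sets lebesgue"
  shows "overlap (A \<union> A') B z = overlap A B z + overlap A' B z"
proof -
  have "{y \<in> B. y + z \<in> A \<union> A'} = {y \<in> B. y + z \<in> A} \<union> {y \<in> B. y + z \<in> A'}"
    by auto
  moreover have "{y \<in> B. y + z \<in> A} \<inter> {y \<in> B. y + z \<in> A'} = {}"
    using assms(1) by auto
  ultimately show ?thesis
    unfolding overlap_def using assms
    by (simp only: plus_emeasure[OF overlap_set_measurable overlap_set_measurable])
qed

text \<open>
  The argument of Steinhaus: take a compact \<open>T \<subseteq> S\<close> of positive measure and an open \<open>V \<supseteq> T\<close> that exceeds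
  \<open>T\<close> by less than \<open>|T|\<close>. A small translate of \<open>T\<close> stays inside \<open>V\<close>; if it met \<open>T\<close> only in a null
  set, then \<open>V - T\<close> would have room for all of it, which has measure \<open>|T|\<close>.
\<close>

lemma steinhaus_self_intersection:
  fixes S :: "'a::euclidean_space set"
  assumes S: "S \<in> sets lebesgue" "\<not> negligible S"
  obtains e where "e > 0" "\<And>h. norm h < e \<Longrightarrow> \<not> negligible (S \<inter> (+) h ` S)"
proof -
  \<comment> \<open>Cutting \<open>S\<close> down to a box makes its measure finite and the closed inner approximation compact.\<close>
  obtain a b where ab: "\<not> negligible (S \<inter> cbox a b)"
    using S(2) negligible_on_intervals by blast
  define C where "C = S \<inter> cbox a b"
  have C: "C \<in> lmeasurable"
    unfolding C_def using S(1)
    by (metis fmeasurable_Int_fmeasurable inf_commute lmeasurable_cbox)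
  have C_pos: "measure lebesgue C > 0"
    using ab C negligible_iff_measure0[of C] unfolding C_def
    by (metis measure_nonneg order_le_less)
  obtain T where T: "closed T" "T \<subseteq> C" "emeasure lebesgue (C - T) < ennreal (measure lebesgue C)"
    using sets_lebesgue_inner_closed[of C "measure lebesgue C"] C C_pos by (metis fmeasurableD)
  have "compact T"
    using T(1,2) unfolding C_def by (metis bounded_cbox bounded_subset compact_eq_bounded_closed le_inf_iff)
  then have T_meas: "T \<in> lmeasurable"
    by (rule lmeasurable_compact)
  have "\<not> negligible T"
  proof
    assume "negligible T"
    then have "emeasure lebesgue (C - T) = emeasure lebesgue C"
      using C by (intro emeasure_Diff_null_set) (auto simp: negligible_iff_null_sets)
    then show False
      using T(3) C by (simp add: emeasure_eq_measure2)
  qed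
  then have T_pos: "measure lebesgue T > 0"
    using T_meas negligible_iff_measure0[of T] by (metis measure_nonneg order_le_less)
  obtain V where V: "open V" "T \<subseteq> V" "emeasure lebesgue (V - T) < ennreal (measure lebesgue T)"
    using sets_lebesgue_outer_open[of T "measure lebesgue T"] T_meas T_pos by (metis fmeasurableD)
  obtain e where e: "e > 0" "(\<Union>x\<in>T. ball x e) \<subseteq> V"
    using compact_subset_open_imp_ball_epsilon_subset[OF \<open>compact T\<close> V(1,2)] by metis
  show thesis
  proof
    show "e > 0"
      by fact
    fix h :: 'a
    assume h: "norm h < e"
    have hT: "(+) h ` T \<in> sets lebesgue"
      using T_meas by (intro lebesgue_sets_translation) auto
    show "\<not> negligible (S \<inter> (+) h ` S)"
    proof
      assume "negligible (S \<inter> (+) h ` S)"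
      then have "negligible (T \<inter> (+) h ` T)"
        by (rule negligible_subset) (use T(2) C_def in auto)
      then have "emeasure lebesgue ((+) h ` T) = emeasure lebesgue ((+) h ` T - (T \<inter> (+) h ` T))"
        using hT by (intro emeasure_Diff_null_set[symmetric]) (auto simp: negligible_iff_null_sets)
      also have "\<dots> \<le> emeasure lebesgue (V - T)"
      proof (rule emeasure_mono)
        have "h + x \<in> V" if "x \<in> T" for x
        proof -
          have "h + x \<in> ball x e"
            using h by (simp add: dist_norm norm_minus_commute)
          with that e(2) show ?thesis
            by blast
        qed
        then show "(+) h ` T - (T \<inter> (+) h ` T) \<subseteq> V - T"
          by auto
        show "V - T \<in> sets lebesgue"
          using V(1) T_meas by auto
      qed
      also have "\<dots> < emeasure lebesgue T"
        using V(3) T_meas by (simp add: emeasure_eq_measure2)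
      finally show False
        by (simp add: emeasure_lebesgue_translation)
    qed
  qed
qed

text \<open>
  If \<open>C\<close> is the overlap set at \<open>z\<close>, then \<open>y\<close> lies in the overlap set at \<open>w\<close> as soon as \<open>y\<close> and
  \<open>y + (w - z)\<close> both lie in \<open>C\<close>, and for small \<open>w - z\<close> there are many such \<open>y\<close>. This lower bound
  replaces the continuity of the convolution of two indicator functions.
\<close>

lemma open_overlap_pos:
  assumes A: "A \<in> sets lebesgue" and B: "B \<in> sets lebesgue"
  shows "open {z. overlap A B z \<noteq> 0}"
proof (rule openI)
  fix z
  assume z: "z \<in> {z. overlap A B z \<noteq> 0}"
  define C where "C = {y \<in> B. y + z \<in> A}"
  have C: "C \<in> sets lebesgue"
    unfolding C_def by (rule overlap_set_measurable[OF A B])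
  have "\<not> negligible C"
    using z C negligible_iff_emeasure0[OF C] by (simp add: overlap_def C_def)
  then obtain e where e: "e > 0" "\<And>h. norm h < e \<Longrightarrow> \<not> negligible (C \<inter> (+) h ` C)"
    using steinhaus_self_intersection[OF C] by metis
  have "overlap A B w \<noteq> 0" if "w \<in> ball z e" for w
  proof
    assume "overlap A B w = 0"
    then have "negligible {y \<in> B. y + w \<in> A}"
      using overlap_set_measurable[OF A B] by (simp add: overlap_def negligible_iff_emeasure0)
    moreover have "C \<inter> (+) (z - w) ` C \<subseteq> {y \<in> B. y + w \<in> A}"
      by (auto simp: C_def algebra_simps)
    ultimately show False
      using e(2)[of "z - w"] that negligible_subset by (auto simp: dist_norm)
  qed
  then show "\<exists>e>0. ball z e \<subseteq> {z. overlap A B z \<noteq> 0}"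
    using e(1) by auto
qed

section \<open>Interaction energies\<close>

text \<open>
  For a kernel that is not even, \<open>interaction K A B\<close> and \<open>interaction K B A\<close> differ in general.
\<close>

definition interaction :: "('a::euclidean_space \<Rightarrow> ennreal) \<Rightarrow> 'a set \<Rightarrow> 'a set \<Rightarrow> ennreal" where
  "interaction K A B =
     (\<integral>\<^sup>+ y. (\<integral>\<^sup>+ x. indicator B y * indicator A x * K (x - y) \<partial>lebesgue) \<partial>lebesgue)"

lemma interaction_borel:
  fixes K :: "'a::euclidean_space \<Rightarrow> ennreal"
  assumes [measurable]: "K \<in> borel_measurable borel" "A \<in> sets borel" "B \<in> sets borel"
  shows "interaction K A B = (\<integral>\<^sup>+ z. K z * overlap A B z \<partial>lebesgue)"
    and "overlap A B \<in> borel_measurable borel"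
proof -
  have ov: "overlap A B z = (\<integral>\<^sup>+ y. indicator B y * indicator A (y + z) \<partial>lborel)" for z
  proof -
    have "{y \<in> B. y + z \<in> A} \<in> sets borel"
      by measurable
    then have "overlap A B z = (\<integral>\<^sup>+ y. indicator {y \<in> B. y + z \<in> A} y \<partial>lborel)"
      unfolding overlap_def by (simp add: nn_integral_indicator)
    also have "\<dots> = (\<integral>\<^sup>+ y. indicator B y * indicator A (y + z) \<partial>lborel)"
      by (intro nn_integral_cong) (auto simp: indicator_def)
    finally show ?thesis .
  qed
  show "overlap A B \<in> borel_measurable borel"
    unfolding ov[abs_def] by measurable
  have "interaction K A B = (\<integral>\<^sup>+ y. (\<integral>\<^sup>+ x. indicator B y * indicator A x * K (x - y) \<partial>lborel) \<partial>lborel)"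
    unfolding interaction_def nn_integral_completion ..
  also have "\<dots> = (\<integral>\<^sup>+ y. (\<integral>\<^sup>+ z. indicator B y * indicator A (z + y) * K z \<partial>lborel) \<partial>lborel)"
  proof (rule nn_integral_cong)
    fix y
    have "(\<lambda>x. indicator B y * indicator A x * K (x - y)) \<in> borel_measurable borel"
      by measurable
    from nn_integral_lborel_translation[OF this, of y]
    show "(\<integral>\<^sup>+ x. indicator B y * indicator A x * K (x - y) \<partial>lborel) =
        (\<integral>\<^sup>+ z. indicator B y * indicator A (z + y) * K z \<partial>lborel)"
      by simp
  qed
  also have "\<dots> = (\<integral>\<^sup>+ z. (\<integral>\<^sup>+ y. indicator B y * indicator A (z + y) * K z \<partial>lborel) \<partial>lborel)"
    by (rule lborel_pair.Fubini') measurable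
  also have "\<dots> = (\<integral>\<^sup>+ z. K z * overlap A B z \<partial>lborel)"
    unfolding ov
    by (intro nn_integral_cong, subst nn_integral_cmult[symmetric]) (auto simp: ac_simps)
  finally show "interaction K A B = (\<integral>\<^sup>+ z. K z * overlap A B z \<partial>lebesgue)"
    by (simp add: nn_integral_completion)
qed

lemma
  fixes K :: "'a::euclidean_space \<Rightarrow> ennreal"
  assumes K: "K \<in> borel_measurable lebesgue" and A: "A \<in> sets lebesgue" and B: "B \<in> sets lebesgue"
  shows interaction_eq_overlap: "interaction K A B = (\<integral>\<^sup>+ z. K z * overlap A B z \<partial>lebesgue)"
    and overlap_measurable: "overlap A B \<in> borel_measurable lebesgue"
    and interaction_inner_measurable:
      "(\<lambda>y. \<integral>\<^sup>+ x. indicator B y * indicator A x * K (x - y) \<partial>lebesgue) \<in> borel_measurable lebesgue"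
      (is "?g \<in> _")
proof -
  obtain A' where A': "A' \<in> sets borel" "AE x in lebesgue. x \<in> A \<longleftrightarrow> x \<in> A'"
    using lebesgue_set_AE_borel[OF A] .
  obtain B' where B': "B' \<in> sets borel" "AE x in lebesgue. x \<in> B \<longleftrightarrow> x \<in> B'"
    using lebesgue_set_AE_borel[OF B] .
  obtain K' where K'_meas: "K' \<in> borel_measurable borel" and K': "AE x in lebesgue. K x = K' x"
    using completion_ex_borel_measurable[OF K] AE_completion by (auto simp: measurable_lborel1)
  note [measurable] = A'(1) B'(1) K'_meas
  let ?g' = "\<lambda>y. \<integral>\<^sup>+ x. indicator B' y * indicator A' x * K' (x - y) \<partial>lebesgue"
  have ov: "overlap A B = overlap A' B'"
    using A'(1) B'(1) by (intro ext overlap_cong_AE A'(2) B'(2) A B) auto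
  have inner: "(\<integral>\<^sup>+ x. indicator B y * indicator A x * K (x - y) \<partial>lebesgue) = ?g' y"
    if "y \<in> B \<longleftrightarrow> y \<in> B'" for y
  proof (rule nn_integral_cong_AE)
    have "AE x in lebesgue. K (x - y) = K' (x - y)"
      using AE_lebesgue_translation[OF K', of "- y"] by simp
    then show "AE x in lebesgue. indicator B y * indicator A x * K (x - y) =
        indicator B' y * indicator A' x * K' (x - y)"
      using A'(2) by eventually_elim (use that in \<open>auto simp: indicator_def\<close>)
  qed
  have outer: "AE y in lebesgue. ?g y = ?g' y"
    using B'(2) by eventually_elim (rule inner)
  have "?g' \<in> borel_measurable borel"
    unfolding nn_integral_completion by measurable
  then have "?g' \<in> borel_measurable lebesgue"
    by (simp add: measurable_completion measurable_lborel1)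
  then show "?g \<in> borel_measurable lebesgue"
    by (rule lebesgue_measurable_cong_AE) (use outer in eventually_elim, simp)
  show "overlap A B \<in> borel_measurable lebesgue"
    unfolding ov using interaction_borel(2)[OF K'_meas A'(1) B'(1)]
    by (simp add: measurable_completion measurable_lborel1)
  have "interaction K A B = interaction K' A' B'"
    unfolding interaction_def by (rule nn_integral_cong_AE[OF outer])
  also have "\<dots> = (\<integral>\<^sup>+ z. K' z * overlap A' B' z \<partial>lebesgue)"
    by (rule interaction_borel(1)) (use A' B' K'_meas in auto)
  also have "\<dots> = (\<integral>\<^sup>+ z. K z * overlap A B z \<partial>lebesgue)"
    unfolding ov by (rule nn_integral_cong_AE) (use K' in eventually_elim, simp)
  finally show "interaction K A B = (\<integral>\<^sup>+ z. K z * overlap A B z \<partial>lebesgue)" .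
qed

lemma interaction_Un_left:
  assumes "K \<in> borel_measurable lebesgue" "A \<inter> A' = {}"
    and "A \<in> sets lebesgue" "A' \<in> sets lebesgue" "B \<in> sets lebesgue"
  shows "interaction K (A \<union> A') B = interaction K A B + interaction K A' B"
  using assms overlap_measurable[of K]
  by (simp add: interaction_eq_overlap overlap_Un_left distrib_left nn_integral_add sets.Un
      del: nn_integral_completion)

lemma interaction_Un_right:
  assumes "K \<in> borel_measurable lebesgue" "B \<inter> B' = {}"
    and "A \<in> sets lebesgue" "B \<in> sets lebesgue" "B' \<in> sets lebesgue"
  shows "interaction K A (B \<union> B') = interaction K A B + interaction K A B'"
proof -
  have "overlap A (B \<union> B') z = overlap A B z + overlap A B' z" for z
    using assms overlap_Un_left[of B B' A "- z"] overlap_commute by metis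
  then show ?thesis
    using assms overlap_measurable[of K]
    by (simp add: interaction_eq_overlap distrib_left nn_integral_add sets.Un)
qed

text \<open>
  This is the interaction formula for the constant kernel \<open>1\<close>.
\<close>

lemma nn_integral_overlap:
  assumes "A \<in> sets lebesgue" "B \<in> sets lebesgue"
  shows "(\<integral>\<^sup>+ z. overlap A B z \<partial>lebesgue) = emeasure lebesgue A * emeasure lebesgue B"
proof -
  have "(\<integral>\<^sup>+ z. overlap A B z \<partial>lebesgue) = interaction (\<lambda>_. 1) A B"
    using interaction_eq_overlap[of "\<lambda>_. 1", OF _ assms] by simp
  also have "\<dots> = (\<integral>\<^sup>+ y. emeasure lebesgue A * indicator B y \<partial>lebesgue)"
    unfolding interaction_def mult_1_right nn_integral_cmult_indicator[OF assms(1)]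
    by (simp only: mult.commute)
  also have "\<dots> = emeasure lebesgue A * emeasure lebesgue B"
    by (rule nn_integral_cmult_indicator[OF assms(2)])
  finally show ?thesis .
qed

section \<open>The perimeter of a partition\<close>

text \<open>
  At the origin \<open>1 / 0 = 0\<close> makes the kernel vanish, in agreement with the integrand of the
  perimeter on the diagonal; \<open>\<rho> z = 0\<close> follows from the vanishing of the kernel only for \<open>z \<noteq> 0\<close>.
\<close>

definition gagliardo_kernel :: "('a::euclidean_space \<Rightarrow> ennreal) \<Rightarrow> 'a \<Rightarrow> ennreal" where
  "gagliardo_kernel \<rho> z = ennreal (1 / norm z) * \<rho> z"

lemma gagliardo_kernel_measurable:
  assumes "\<rho> \<in> borel_measurable lebesgue"
  shows "gagliardo_kernel \<rho> \<in> borel_measurable lebesgue"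
proof -
  have "(\<lambda>z::'a. ennreal (1 / norm z)) \<in> borel_measurable lebesgue"
    by (intro measurable_completion) measurable
  then show ?thesis
    unfolding gagliardo_kernel_def[abs_def] using assms by (rule borel_measurable_times_ennreal)
qed

lemma gagliardo_perimeter_eq_interaction:
  assumes \<rho>: "\<rho> \<in> borel_measurable lebesgue" and E: "E \<in> sets lebesgue"
  shows "gagliardo_perimeter \<rho> E =
    interaction (gagliardo_kernel \<rho>) (- E) E + interaction (gagliardo_kernel \<rho>) E (- E)"
proof -
  let ?K = "gagliardo_kernel \<rho>"
  note K = gagliardo_kernel_measurable[OF \<rho>]
  have cE: "- E \<in> sets lebesgue"
    using E by (rule Compl_in_sets_lebesgue[THEN iffD2])
  have split: "ennreal (\<bar>indicat_real E x - indicat_real E y\<bar> / norm (x - y)) * \<rho> (x - y) =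
    indicator E y * indicator (- E) x * ?K (x - y) + indicator (- E) y * indicator E x * ?K (x - y)" for x y
    by (auto simp: indicator_def gagliardo_kernel_def)
  have inner: "(\<integral>\<^sup>+ x. ennreal (\<bar>indicat_real E x - indicat_real E y\<bar> / norm (x - y)) * \<rho> (x - y) \<partial>lebesgue) =
    (\<integral>\<^sup>+ x. indicator E y * indicator (- E) x * ?K (x - y) \<partial>lebesgue) +
    (\<integral>\<^sup>+ x. indicator (- E) y * indicator E x * ?K (x - y) \<partial>lebesgue)" for y
    \<comment> \<open>For fixed \<open>y\<close> one of the two integrands on the right is identically zero.\<close>
  proof (cases "y \<in> E")
    case True
    then show ?thesis unfolding split by (simp add: indicator_def)
  next
    case False
    then show ?thesis unfolding split by (simp add: indicator_def)
  qed
  show ?thesis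
    unfolding gagliardo_perimeter_def inner interaction_def
    by (rule nn_integral_add) (intro interaction_inner_measurable K E cE)+
qed

text \<open>
  A part \<open>E1\<close> interacts with the outside of \<open>E\<close> and with \<open>E2\<close>. The interactions with the outside add
  up to the perimeter of the union; the mutual interaction of the parts is counted once in each
  of their perimeters.
\<close>

lemma gagliardo_perimeter_partition:
  assumes \<rho>: "\<rho> \<in> borel_measurable lebesgue"
    and E: "E1 \<in> sets lebesgue" "E2 \<in> sets lebesgue" "E1 \<inter> E2 = {}"
  defines "X \<equiv> interaction (gagliardo_kernel \<rho>) E1 E2 + interaction (gagliardo_kernel \<rho>) E2 E1"
  shows "gagliardo_perimeter \<rho> E1 + gagliardo_perimeter \<rho> E2 =
    gagliardo_perimeter \<rho> (E1 \<union> E2) + (X + X)"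
proof -
  let ?J = "interaction (gagliardo_kernel \<rho>)"
  note K = gagliardo_kernel_measurable[OF \<rho>]
  define C where "C = - (E1 \<union> E2)"
  have C: "C \<in> sets lebesgue"
    unfolding C_def using E(1,2) by (simp add: Compl_in_sets_lebesgue sets.Un)
  have compl: "- E1 = C \<union> E2" "- E2 = C \<union> E1"
    and disj: "C \<inter> E1 = {}" "C \<inter> E2 = {}"
    using E(3) by (auto simp: C_def)
  have "gagliardo_perimeter \<rho> E1 = ?J C E1 + ?J E2 E1 + (?J E1 C + ?J E1 E2)"
    using K E C disj
    by (simp add: gagliardo_perimeter_eq_interaction[OF \<rho>] compl interaction_Un_left interaction_Un_right)
  moreover have "gagliardo_perimeter \<rho> E2 = ?J C E2 + ?J E1 E2 + (?J E2 C + ?J E2 E1)"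
    using K E C disj
    by (simp add: gagliardo_perimeter_eq_interaction[OF \<rho>] compl interaction_Un_left interaction_Un_right)
  moreover have "gagliardo_perimeter \<rho> (E1 \<union> E2) = ?J C E1 + ?J C E2 + (?J E1 C + ?J E2 C)"
    unfolding gagliardo_perimeter_eq_interaction[OF \<rho> sets.Un[OF E(1,2)]] C_def[symmetric]
    using K E C by (simp add: interaction_Un_left interaction_Un_right)
  ultimately show ?thesis
    by (simp add: X_def ac_simps)
qed

section \<open>Vanishing overlaps\<close>

lemma
  assumes A: "A \<in> sets lebesgue"
  shows AE_in_support_restriction:
      "AE x in lebesgue. x \<in> A \<longrightarrow> x \<in> measure_support (lebesgue_restriction A)"
    and support_restriction_nhd:
      "x \<in> measure_support (lebesgue_restriction A) \<Longrightarrow> open U \<Longrightarrow> x \<in> U \<Longrightarrow> emeasure lebesgue (A \<inter> U) > 0"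
proof -
  let ?S = "measure_support (lebesgue_restriction A)"
  have sets: "sets borel \<subseteq> sets (lebesgue_restriction A)"
    by (auto simp: lebesgue_restriction_def)
  have em: "emeasure (lebesgue_restriction A) X = emeasure lebesgue (A \<inter> X)" if "X \<in> sets borel" for X
  proof -
    have "emeasure (lebesgue_restriction A) X = (\<integral>\<^sup>+ x. indicator A x * indicator X x \<partial>lebesgue)"
      unfolding lebesgue_restriction_def using A that by (intro emeasure_density) auto
    also have "\<dots> = (\<integral>\<^sup>+ x. indicator (A \<inter> X) x \<partial>lebesgue)"
      by (simp add: indicator_inter_arith)
    also have "\<dots> = emeasure lebesgue (A \<inter> X)"
      using A that by (intro nn_integral_indicator) auto
    finally show ?thesis .
  qed
  have S: "closed ?S" "emeasure (lebesgue_restriction A) (UNIV - ?S) = 0"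
    using measure_support_smallest(1)[OF sets] by auto
  then have "UNIV - ?S \<in> sets borel"
    by auto
  with S(2) A have "A \<inter> (UNIV - ?S) \<in> null_sets lebesgue"
    by (intro null_setsI) (auto simp: em)
  then show "AE x in lebesgue. x \<in> A \<longrightarrow> x \<in> ?S"
    using AE_not_in by fastforce
  show "emeasure lebesgue (A \<inter> U) > 0" if "x \<in> ?S" "open U" "x \<in> U" for x U
  proof (rule ccontr)
    assume "\<not> ?thesis"
    then have "emeasure (lebesgue_restriction A) (UNIV - - U) = 0"
      using that(2) by (simp add: em Diff_eq)
    then have "?S \<subseteq> - U"
      using that(2) by (intro measure_support_smallest(2)[OF sets]) auto
    with that show False
      by auto
  qed
qed

text \<open>
  Almost every point of a set lies in its support, so separated supports leave no overlap at small
  \<open>z\<close>. Conversely, two support points at distance less than \<open>\<epsilon>\<close> have neighbourhoods \<open>U\<close> and \<open>V\<close> all of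
  whose differences are shorter than \<open>\<epsilon>\<close>; then the overlap of \<open>A \<inter> U\<close> and \<open>B \<inter> V\<close> vanishes at every
  \<open>z\<close>, which contradicts that its integral is a product of two positive measures.
\<close>

lemma ess_dist_ge_iff_overlap:
  fixes A B :: "'a::euclidean_space set"
  assumes A: "A \<in> sets lebesgue" and B: "B \<in> sets lebesgue"
  shows "ess_dist A B \<ge> ereal \<epsilon> \<longleftrightarrow> (\<forall>z. norm z < \<epsilon> \<longrightarrow> overlap A B z = 0)"
proof -
  let ?SA = "measure_support (lebesgue_restriction A)"
  let ?SB = "measure_support (lebesgue_restriction B)"
  have "ess_dist A B \<ge> ereal \<epsilon> \<longleftrightarrow> (\<forall>x\<in>?SA. \<forall>y\<in>?SB. \<epsilon> \<le> norm (x - y))"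
    by (auto simp: ess_dist_def le_INF_iff)
  also have "\<dots> \<longleftrightarrow> (\<forall>z. norm z < \<epsilon> \<longrightarrow> overlap A B z = 0)"
  proof safe
    fix z :: 'a
    assume sep: "\<forall>x\<in>?SA. \<forall>y\<in>?SB. \<epsilon> \<le> norm (x - y)" and z: "norm z < \<epsilon>"
    have "AE y in lebesgue. \<not> (y \<in> B \<and> y + z \<in> A)"
      using AE_in_support_restriction[OF B]
        AE_lebesgue_translation[OF AE_in_support_restriction[OF A], of z]
    proof eventually_elim
      case (elim y)
      show ?case
      proof
        assume "y \<in> B \<and> y + z \<in> A"
        with elim sep have "\<epsilon> \<le> norm (y + z - y)"
          by blast
        with z show False
          by simp
      qed
    qed
    then show "overlap A B z = 0"
      unfolding overlap_def using emeasure_eq_0_AE[of "\<lambda>y. y \<in> B \<and> y + z \<in> A" lebesgue] by simp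
  next
    fix x y
    assume ov: "\<forall>z. norm z < \<epsilon> \<longrightarrow> overlap A B z = 0" and x: "x \<in> ?SA" and y: "y \<in> ?SB"
    show "\<epsilon> \<le> norm (x - y)"
    proof (rule ccontr)
      assume "\<not> \<epsilon> \<le> norm (x - y)"
      \<comment> \<open>Moving both points by less than \<open>r\<close> keeps their distance below \<open>\<epsilon>\<close>.\<close>
      define r where "r = (\<epsilon> - norm (x - y)) / 2"
      have "r > 0"
        using \<open>\<not> \<epsilon> \<le> norm (x - y)\<close> by (simp add: r_def)
      let ?A = "A \<inter> ball x r" and ?B = "B \<inter> ball y r"
      have meas: "?A \<in> sets lebesgue" "?B \<in> sets lebesgue"
        using A B by auto
      have "overlap ?A ?B z = 0" for z
      proof (cases "{w \<in> ?B. w + z \<in> ?A} = {}")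
        case True
        then show ?thesis
          unfolding overlap_def True by simp
      next
        case False
        then obtain w where w: "dist y w < r" "dist x (w + z) < r"
          by auto
        have "norm z = norm ((x - y) - (x - (w + z)) + (y - w))"
          by (simp add: algebra_simps)
        also have "\<dots> \<le> norm (x - y) + norm (x - (w + z)) + norm (y - w)"
          by (metis add_mono_thms_linordered_semiring(3) norm_triangle_ineq norm_triangle_ineq4 order_trans)
        also have "\<dots> < \<epsilon>"
          using w by (simp add: dist_norm r_def field_simps)
        finally have "overlap A B z = 0"
          using ov by blast
        moreover have "overlap ?A ?B z \<le> overlap A B z"
          unfolding overlap_def by (intro emeasure_mono overlap_set_measurable A B) auto
        ultimately show ?thesis
          by simp
      qed
      then have "emeasure lebesgue ?A * emeasure lebesgue ?B = 0"
        using nn_integral_overlap[OF meas] by simp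
      moreover have "emeasure lebesgue ?A > 0" "emeasure lebesgue ?B > 0"
        using support_restriction_nhd[OF A x, of "ball x r"] support_restriction_nhd[OF B y, of "ball y r"]
          \<open>r > 0\<close> by auto
      ultimately show False
        by auto
    qed
  qed
  finally show ?thesis .
qed

text \<open>
  If \<open>J(A, B) = 0\<close>, the open set where the overlap is positive is null for \<open>\<rho>\<close>, hence disjoint
  from the essential support. Conversely, \<open>\<rho>\<close> vanishes outside the closed ball, whose boundary sphere
  is a null set.
\<close>

lemma interaction_eq_0_iff_overlap:
  assumes \<rho>: "\<rho> \<in> borel_measurable lebesgue" and supp: "ess_support \<rho> = cball 0 \<epsilon>"
    and A: "A \<in> sets lebesgue" and B: "B \<in> sets lebesgue"
  shows "interaction (gagliardo_kernel \<rho>) A B = 0 \<longleftrightarrow> (\<forall>z. norm z < \<epsilon> \<longrightarrow> overlap A B z = 0)"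
proof -
  let ?K = "gagliardo_kernel \<rho>"
  note K = gagliardo_kernel_measurable[OF \<rho>]
  have "interaction ?K A B = 0 \<longleftrightarrow> (AE z in lebesgue. ?K z * overlap A B z = 0)"
    unfolding interaction_eq_overlap[OF K A B]
    by (rule nn_integral_0_iff_AE) (intro borel_measurable_times_ennreal K overlap_measurable[OF K A B])
  also have "\<dots> \<longleftrightarrow> (\<forall>z. norm z < \<epsilon> \<longrightarrow> overlap A B z = 0)"
  proof
    assume ov: "\<forall>z. norm z < \<epsilon> \<longrightarrow> overlap A B z = 0"
    have "AE z in lebesgue. z \<notin> sphere 0 \<epsilon>"
      by (intro AE_not_in) (simp add: negligible_iff_null_sets[symmetric] negligible_sphere)
    moreover have "AE z in lebesgue. z \<notin> cball 0 \<epsilon> \<longrightarrow> \<rho> z = 0"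
      using ess_support_smallest(1)[of \<rho>] supp by simp
    ultimately show "AE z in lebesgue. ?K z * overlap A B z = 0"
    proof eventually_elim
      case (elim z)
      then show ?case
        using ov by (cases "norm z < \<epsilon>") (auto simp: gagliardo_kernel_def)
    qed
  next
    assume prod0: "AE z in lebesgue. ?K z * overlap A B z = 0"
    have "AE z in lebesgue. z \<noteq> (0::'a)"
      by (intro AE_completion AE_lborel_singleton)
    with prod0 have "AE z in lebesgue. z \<notin> - {z. overlap A B z \<noteq> 0} \<longrightarrow> \<rho> z = 0"
      by eventually_elim (auto simp: gagliardo_kernel_def)
    then have "cball 0 \<epsilon> \<subseteq> - {z. overlap A B z \<noteq> 0}"
      unfolding supp[symmetric] using open_overlap_pos[OF A B]
      by (intro ess_support_smallest(2)) auto
    then show "\<forall>z. norm z < \<epsilon> \<longrightarrow> overlap A B z = 0"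
      by (auto simp: subset_iff)
  qed
  finally show ?thesis .
qed

section \<open>Decomposability\<close>

theorem proposition2p2:
  fixes \<epsilon> :: real
    and \<rho> :: "real ^ 'd \<Rightarrow> ennreal"
    and E :: "(real ^ 'd) set"
  assumes "\<epsilon> > 0"
    and "\<rho> \<in> borel_measurable lebesgue"
    and "ess_support \<rho> = closure (ball 0 \<epsilon>)"
    and "E \<in> sets lebesgue"
    and "gagliardo_perimeter \<rho> E < \<infinity>"
  shows "decomposable \<rho> E \<longleftrightarrow>
    (\<exists>E1 E2. E1 \<in> sets lebesgue \<and> E2 \<in> sets lebesgue \<and>
       E1 \<union> E2 = E \<and> E1 \<inter> E2 = {} \<and>
       emeasure lebesgue E1 > 0 \<and> emeasure lebesgue E2 > 0 \<and>
       ess_dist E1 E2 \<ge> ereal \<epsilon>)"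
proof -
  let ?P = "gagliardo_perimeter \<rho>" and ?J = "interaction (gagliardo_kernel \<rho>)"
  have supp: "ess_support \<rho> = cball 0 \<epsilon>"
    using assms(1,3) by simp
  \<comment> \<open>The two conditions agree for each single partition, not only after quantification.\<close>
  have key: "?P E1 < \<infinity> \<and> ?P E2 < \<infinity> \<and> ?P E = ?P E1 + ?P E2 \<longleftrightarrow> ess_dist E1 E2 \<ge> ereal \<epsilon>"
    if E12: "E1 \<in> sets lebesgue" "E2 \<in> sets lebesgue" "E1 \<union> E2 = E" "E1 \<inter> E2 = {}" for E1 E2
  proof -
    have J12: "?J E1 E2 = 0 \<longleftrightarrow> ess_dist E1 E2 \<ge> ereal \<epsilon>"
      using interaction_eq_0_iff_overlap[OF assms(2) supp] ess_dist_ge_iff_overlap E12 by metis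
    have J21: "?J E2 E1 = 0 \<longleftrightarrow> ?J E1 E2 = 0"
      using interaction_eq_0_iff_overlap[OF assms(2) supp] E12 overlap_commute norm_minus_cancel by metis
    define X where "X = ?J E1 E2 + ?J E2 E1"
    have sum: "?P E1 + ?P E2 = ?P E + (X + X)"
      using gagliardo_perimeter_partition[OF assms(2) E12(1,2,4)] E12(3) by (simp add: X_def)
    have "?P E1 < \<infinity> \<and> ?P E2 < \<infinity> \<and> ?P E = ?P E1 + ?P E2 \<longleftrightarrow> X = 0"
    proof
      assume "X = 0"
      with sum have "?P E1 + ?P E2 = ?P E"
        by simp
      with assms(5) show "?P E1 < \<infinity> \<and> ?P E2 < \<infinity> \<and> ?P E = ?P E1 + ?P E2"
        by (metis add_top ennreal_add_eq_top infinity_ennreal_def less_top)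
    next
      assume "?P E1 < \<infinity> \<and> ?P E2 < \<infinity> \<and> ?P E = ?P E1 + ?P E2"
      then have "?P E + (X + X) = ?P E + 0"
        using sum by simp
      then have "X + X = 0"
        using assms(5) by (auto simp: ennreal_add_left_cancel)
      then show "X = 0"
        by simp
    qed
    also have "X = 0 \<longleftrightarrow> ess_dist E1 E2 \<ge> ereal \<epsilon>"
      using J12 J21 by (simp add: X_def)
    finally show ?thesis .
  qed
  show ?thesis
    unfolding decomposable_def using assms(4,5) key by blast
qed

end
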